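(* Let $G$ be a graph (loops allowed). Then $$\mathrm{st}_+(G)=\min\{|\mathscr C| : \mathscr C \text{ is a set-join cover of } G\}.$$
   Context: Graphs are finite, undirected, without multiple edges, with loops allowed: $E(G)\subseteq\{\{i,j\}: i,j\in V(G)\}$, where $\{i\}\in E(G)$ is a loop at $i$. SNT-rank. $\mathcal S_n^+$ is the set of symmetric entrywise nonnegative real $n\times n$ matrices. For $A\in\mathcal S_n^+$, $\mathrm{st}_+(A)$ is the minimal $k\ge 0$ such that $A=BCB^T$ with $B$ an entrywise nonnegative real $n\times k$ matrix and $C\in\mathcal S_k^+$ (the zero matrix has $\mathrm{st}_+=0$). The pattern graph $G(A)$ of $A$ has vertex set $[n]=\{1,\dots,n\}$ and $\{i,j\}\in E(G(A))$ iff $a_{ij}>0$ (so $\{i\}$ is a loop iff $a_{ii}>0$). For a graph $G$ with $n$ vertices (identified with $[n]$), $\mathcal S^+(G)=\{A\in\mathcal S_n^+: G(A)=G\}$ and $\mathrm{st}_+(G)=\min\{\mathrm{st}_+(A): A\in\mathcal S^+(G)\}$. Set-join covers. For a finite set $S$ and nonempty, possibly intersecting or equal, subsets $K,L\subseteq S$, the set-join $K\vee_S L$ is the graph with vertex set $S$ and edge set $\{\{i,j\}: i\in K, j\in L\}$ (so it has a loop at each $i\in K\cap L$). A set-join cover of $G$ is a set $\mathscr C=\{K_i\vee_{V(G)}L_i : i\in[t]\}$ (possibly empty) with $E(G)=\bigcup_{i=1}^t E(K_i\vee_{V(G)}L_i)$. Its component set is $V(\mathscr C)=\{K_i: i\in[t]\}\cup\{L_i: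 i\in[t]\}$ and its order is $|\mathscr C|:=|V(\mathscr C)|$, the number of distinct components. *)

theory Defs
  imports "Jordan_Normal_Form.Matrix"
begin

section \<open>Graphs with loops\<close>

text \<open>An edge is a set \<open>{i, j}\<close> of vertices; the case \<open>i = j\<close> is a loop.\<close>

record 'a loop_graph =
  verts :: "'a set"
  edges :: "'a set set"

definition finite_loop_graph :: "'a loop_graph \<Rightarrow> bool" where
  "finite_loop_graph G \<longleftrightarrow>
     finite (verts G) \<and> edges G \<subseteq> {{i, j} | i j. i \<in> verts G \<and> j \<in> verts G}"

definition relabel :: "('a \<Rightarrow> 'b) \<Rightarrow> 'a loop_graph \<Rightarrow> 'b loop_graph" where
  "relabel \<phi> G = \<lparr> verts = \<phi> ` verts G, edges = (\<lambda>e. \<phi> ` e) ` edges G \<rparr>"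

section \<open>SNT-rank\<close>

text \<open>
  Matrices are indexed from \<open>0\<close>, so \<open>{0..<n}\<close> plays the role of \<open>[n]\<close>.
  The order on matrices of equal dimensions is entrywise.
\<close>

definition sym_nonneg_mats :: "nat \<Rightarrow> real mat set" where
  "sym_nonneg_mats n = {A \<in> carrier_mat n n. A\<^sup>T = A \<and> 0\<^sub>m n n \<le> A}"

definition snt_factorizable :: "real mat \<Rightarrow> nat \<Rightarrow> bool" where
  "snt_factorizable A k \<longleftrightarrow>
     (\<exists>B C. B \<in> carrier_mat (dim_row A) k \<and> 0\<^sub>m (dim_row A) k \<le> B \<and>
            C \<in> sym_nonneg_mats k \<and> A = B * C * B\<^sup>T)"

definition st_plus :: "real mat \<Rightarrow> nat" where
  "st_plus A = (LEAST k. snt_factorizable A k)"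

definition pattern_graph :: "real mat \<Rightarrow> nat loop_graph" where
  "pattern_graph A =
     \<lparr> verts = {0..<dim_row A},
       edges = {{i, j} | i j. i < dim_row A \<and> j < dim_row A \<and> A $$ (i, j) > 0} \<rparr>"

text \<open>
  The enumeration \<open>\<phi>\<close> is the identification of \<open>{0..<n}\<close> with the vertex set of \<open>G\<close>.
\<close>

definition vertex_enumeration :: "(nat \<Rightarrow> 'a) \<Rightarrow> 'a loop_graph \<Rightarrow> bool" where
  "vertex_enumeration \<phi> G \<longleftrightarrow> bij_betw \<phi> {0..<card (verts G)} (verts G)"

definition sym_nonneg_mats_of_graph :: "(nat \<Rightarrow> 'a) \<Rightarrow> 'a loop_graph \<Rightarrow> real mat set" where
  "sym_nonneg_mats_of_graph \<phi> G =
     {A \<in> sym_nonneg_mats (card (verts G)). relabel \<phi> (pattern_graph A) = G}"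

definition st_plus_graph :: "(nat \<Rightarrow> 'a) \<Rightarrow> 'a loop_graph \<Rightarrow> nat" where
  "st_plus_graph \<phi> G = (LEAST k. k \<in> st_plus ` sym_nonneg_mats_of_graph \<phi> G)"

section \<open>Set-join covers\<close>

definition set_join :: "'a set \<Rightarrow> 'a set \<Rightarrow> 'a set \<Rightarrow> 'a loop_graph" where
  "set_join S K L = \<lparr> verts = S, edges = {{i, j} | i j. i \<in> K \<and> j \<in> L} \<rparr>"

text \<open>
  A set-join in a cover is represented by its pair \<open>(K, L)\<close> of components, so that the
  components can be read off. The order of a pair is irrelevant: swapping \<open>K\<close> and \<open>L\<close>
  changes neither the set-join nor the component set.
\<close>

definition is_set_join_cover :: "('a set \<times> 'a set) set \<Rightarrow> 'a loop_graph \<Rightarrow> bool" where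
  "is_set_join_cover \<C> G \<longleftrightarrow>
     finite \<C> \<and>
     (\<forall>(K, L) \<in> \<C>. K \<noteq> {} \<and> L \<noteq> {} \<and> K \<subseteq> verts G \<and> L \<subseteq> verts G) \<and>
     edges G = (\<Union>(K, L) \<in> \<C>. edges (set_join (verts G) K L))"

definition cover_components :: "('a set \<times> 'a set) set \<Rightarrow> 'a set set" where
  "cover_components \<C> = fst ` \<C> \<union> snd ` \<C>"

definition cover_order :: "('a set \<times> 'a set) set \<Rightarrow> nat" where
  "cover_order \<C> = card (cover_components \<C>)"

section \<open>The minima are attained\<close>

text \<open>The sets of naturals whose least element is taken are nonempty.\<close>

lemma snt_factorizable_dim:
  assumes "A \<in> sym_nonneg_mats n"
  shows "snt_factorizable A n"
proof -
  have A: "A \<in> carrier_mat n n" using assms by (simp add: sym_nonneg_mats_def)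
  have "0\<^sub>m n n \<le> (1\<^sub>m n :: real mat)" by (simp add: less_eq_mat_def)
  moreover have "A = 1\<^sub>m n * A * (1\<^sub>m n)\<^sup>T" using A by simp
  ultimately show ?thesis
    unfolding snt_factorizable_def using A assms
    by (intro exI[of _ "1\<^sub>m n"] exI[of _ A]) auto
qed

lemma sym_nonneg_mats_of_graph_nonempty:
  assumes G: "finite_loop_graph G" and \<phi>: "vertex_enumeration \<phi> G"
  shows "sym_nonneg_mats_of_graph \<phi> G \<noteq> {}"
proof -
  define n where "n = card (verts G)"
  define A :: "real mat" where
    "A = mat n n (\<lambda>(i, j). if {\<phi> i, \<phi> j} \<in> edges G then 1 else 0)"
  have im: "\<phi> ` {0..<n} = verts G"
    using \<phi> by (simp add: vertex_enumeration_def bij_betw_def n_def)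
  have comm: "{\<phi> i, \<phi> j} = {\<phi> j, \<phi> i}" for i j by blast
  have "A\<^sup>T = A"
  proof (rule eq_matI)
    fix i j assume "i < dim_row A" "j < dim_col A"
    then show "A\<^sup>T $$ (i, j) = A $$ (i, j)"
      using comm[of i j] by (simp add: A_def)
  qed (simp_all add: A_def)
  then have "A \<in> sym_nonneg_mats n"
    by (simp add: sym_nonneg_mats_def) (simp add: A_def less_eq_mat_def)
  moreover have "(\<lambda>e. \<phi> ` e) ` edges (pattern_graph A) = edges G"
  proof (intro equalityI subsetI)
    fix e assume "e \<in> (\<lambda>e. \<phi> ` e) ` edges (pattern_graph A)"
    then show "e \<in> edges G"
      by (auto simp: pattern_graph_def A_def split: if_splits)
  next
    fix e assume e: "e \<in> edges G"
    then obtain u v where uv: "e = {u, v}" "u \<in> verts G" "v \<in> verts G"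
      using G by (auto simp: finite_loop_graph_def)
    from uv im have "u \<in> \<phi> ` {0..<n}" "v \<in> \<phi> ` {0..<n}" by simp_all
    then obtain i j where ij: "i < n" "j < n" "u = \<phi> i" "v = \<phi> j" by auto
    have "A $$ (i, j) > 0" using e uv(1) ij by (simp add: A_def)
    moreover have "dim_row A = n" by (simp add: A_def)
    ultimately have "{i, j} \<in> edges (pattern_graph A)"
      unfolding pattern_graph_def using ij by (simp, blast)
    moreover have "e = \<phi> ` {i, j}" using uv(1) ij by simp
    ultimately show "e \<in> (\<lambda>e. \<phi> ` e) ` edges (pattern_graph A)" by (rule rev_image_eqI)
  qed
  ultimately have "A \<in> sym_nonneg_mats_of_graph \<phi> G"
    using im by (simp add: sym_nonneg_mats_of_graph_def relabel_def n_def pattern_graph_def A_def)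
  then show ?thesis by blast
qed

lemma ex_set_join_cover:
  assumes G: "finite_loop_graph G"
  shows "\<exists>\<C>. is_set_join_cover \<C> G"
proof -
  define \<C> where
    "\<C> = (\<lambda>(i, j). ({i}, {j})) ` {(i, j) \<in> verts G \<times> verts G. {i, j} \<in> edges G}"
  have "finite (verts G)" using G by (simp add: finite_loop_graph_def)
  then have "finite (verts G \<times> verts G)" by simp
  then have "finite {(i, j) \<in> verts G \<times> verts G. {i, j} \<in> edges G}"
    by (rule rev_finite_subset) blast
  then have fin: "finite \<C>"
    unfolding \<C>_def by (rule finite_imageI)
  have "edges G = (\<Union>(K, L) \<in> \<C>. edges (set_join (verts G) K L))"
  proof (intro equalityI subsetI)
    fix e assume e: "e \<in> edges G"
    then obtain i j where ij: "e = {i, j}" "i \<in> verts G" "j \<in> verts G"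
      using G unfolding finite_loop_graph_def by blast
    then have "({i}, {j}) \<in> \<C>" using e by (auto simp: \<C>_def)
    moreover have "e \<in> edges (set_join (verts G) {i} {j})"
      using ij(1) by (simp add: set_join_def)
    ultimately show "e \<in> (\<Union>(K, L) \<in> \<C>. edges (set_join (verts G) K L))" by blast
  qed (auto simp: \<C>_def set_join_def)
  moreover have "\<forall>(K, L) \<in> \<C>. K \<noteq> {} \<and> L \<noteq> {} \<and> K \<subseteq> verts G \<and> L \<subseteq> verts G"
    by (auto simp: \<C>_def)
  ultimately have "is_set_join_cover \<C> G"
    unfolding is_set_join_cover_def using fin by blast
  then show ?thesis by blast
qed

end

theory Submission
  imports Defs
begin

text \<open>
  Expanding a product gives \<open>(B C B\<^sup>T)\<^sub>i\<^sub>j = \<Sum>p q. B\<^sub>i\<^sub>p C\<^sub>p\<^sub>q B\<^sub>j\<^sub>q\<close>. With nonnegative factors nothing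
  cancels, so the entry is positive iff some \<open>p, q\<close> make all three factors positive
  (\<open>snt_product_pos_iff\<close>). Let \<open>K\<^sub>p\<close> be the support of column \<open>p\<close> of \<open>B\<close>. The criterion says that
  \<open>{i, j}\<close> is an edge of the pattern graph iff \<open>i \<in> K\<^sub>p\<close> and \<open>j \<in> K\<^sub>q\<close> for some \<open>p, q\<close> with
  \<open>C\<^sub>p\<^sub>q > 0\<close>: the pattern graph is the union of the set-joins \<open>K\<^sub>p \<or> K\<^sub>q\<close> over the positive entries
  of \<open>C\<close>.

  Hence a factorization with inner dimension \<open>k\<close> yields a set-join cover whose components are among
  the at most \<open>k\<close> supports \<open>K\<^sub>p\<close> (\<open>ex_cover_of_snt_factorization\<close>). Conversely, a cover with \<open>k\<close>
  components is realised by the 0-1 matrices \<open>B\<close>, recording which vertex lies in which component,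
  and \<open>C\<close>, recording which components are joined (\<open>ex_snt_factorization_of_cover\<close>). The two minima
  therefore bound each other.
\<close>

section \<open>Products of nonnegative matrices\<close>

lemma zero_le_mat_iff:
  assumes "A \<in> carrier_mat m n"
  shows "0\<^sub>m m n \<le> (A :: real mat) \<longleftrightarrow> (\<forall>i<m. \<forall>j<n. 0 \<le> A $$ (i, j))"
  using assms by (auto simp: less_eq_mat_def)

lemma sum_pos_iff:
  fixes f :: "'b \<Rightarrow> real"
  assumes "finite S" "\<And>x. x \<in> S \<Longrightarrow> 0 \<le> f x"
  shows "sum f S > 0 \<longleftrightarrow> (\<exists>x\<in>S. f x > 0)"
proof -
  have "sum f S = 0 \<longleftrightarrow> (\<forall>x\<in>S. f x = 0)" by (rule sum_nonneg_eq_0_iff[OF assms])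
  moreover have "0 \<le> sum f S" by (rule sum_nonneg[OF assms(2)])
  ultimately show ?thesis using assms(2) by (metis order_less_le)
qed

lemma triple_product_index:
  fixes B C :: "'b::comm_semiring_0 mat"
  assumes "B \<in> carrier_mat n k" "C \<in> carrier_mat k k" "i < n" "j < n"
  shows "(B * C * B\<^sup>T) $$ (i, j) = (\<Sum>p<k. \<Sum>q<k. B $$ (i, p) * C $$ (p, q) * B $$ (j, q))"
  using assms
  by (auto simp: scalar_prod_def atLeast0LessThan sum_distrib_left mult.assoc intro!: sum.cong)

lemma snt_product_pos_iff:
  fixes B C :: "real mat"
  assumes B: "B \<in> carrier_mat n k" "0\<^sub>m n k \<le> B" and C: "C \<in> sym_nonneg_mats k"
    and ij: "i < n" "j < n"
  shows "(B * C * B\<^sup>T) $$ (i, j) > 0 \<longleftrightarrow>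
    (\<exists>p<k. \<exists>q<k. B $$ (i, p) > 0 \<and> C $$ (p, q) > 0 \<and> B $$ (j, q) > 0)"
proof -
  have C': "C \<in> carrier_mat k k" using C by (simp add: sym_nonneg_mats_def)
  have B0: "0 \<le> B $$ (a, p)" if "a < n" "p < k" for a p
    using zero_le_mat_iff[OF B(1)] B(2) that by blast
  have C0: "0 \<le> C $$ (p, q)" if "p < k" "q < k" for p q
    using zero_le_mat_iff[OF C'] C that by (simp add: sym_nonneg_mats_def)
  let ?t = "\<lambda>p q. B $$ (i, p) * C $$ (p, q) * B $$ (j, q)"
  have t0: "0 \<le> ?t p q" if "p < k" "q < k" for p q
    using B0 C0 ij that by simp
  have "?t p q > 0 \<longleftrightarrow> B $$ (i, p) > 0 \<and> C $$ (p, q) > 0 \<and> B $$ (j, q) > 0"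
    if "p < k" "q < k" for p q
    using B0[OF ij(1) that(1)] B0[OF ij(2) that(2)] C0[OF that]
    by (auto simp: zero_less_mult_iff)
  moreover have "(\<Sum>p<k. \<Sum>q<k. ?t p q) > 0 \<longleftrightarrow> (\<exists>p<k. \<exists>q<k. ?t p q > 0)"
  proof -
    have "(\<Sum>p<k. \<Sum>q<k. ?t p q) = (\<Sum>(p, q) \<in> {..<k} \<times> {..<k}. ?t p q)"
      by (rule sum.cartesian_product)
    moreover have "\<dots> > 0 \<longleftrightarrow> (\<exists>(p, q) \<in> {..<k} \<times> {..<k}. ?t p q > 0)"
      using t0 by (subst sum_pos_iff) auto
    ultimately show ?thesis by auto
  qed
  ultimately show ?thesis
    unfolding triple_product_index[OF B(1) C' ij] by auto
qed

lemma snt_product_sym_nonneg: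
  fixes B C :: "real mat"
  assumes B: "B \<in> carrier_mat n k" "0\<^sub>m n k \<le> B" and C: "C \<in> sym_nonneg_mats k"
  shows "B * C * B\<^sup>T \<in> sym_nonneg_mats n"
proof -
  have C': "C \<in> carrier_mat k k" "C\<^sup>T = C" "0\<^sub>m k k \<le> C"
    using C by (simp_all add: sym_nonneg_mats_def)
  have "(B * C * B\<^sup>T)\<^sup>T = (B\<^sup>T)\<^sup>T * (B * C)\<^sup>T"
    by (rule transpose_mult[of _ n k _ n]) (use B(1) C'(1) in auto)
  also have "(B * C)\<^sup>T = C\<^sup>T * B\<^sup>T" by (rule transpose_mult[OF B(1) C'(1)])
  also have "(B\<^sup>T)\<^sup>T * (C\<^sup>T * B\<^sup>T) = B * C * B\<^sup>T"
    using B(1) C'(1) by (simp add: C'(2) assoc_mult_mat[of B n k C k "B\<^sup>T" n])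
  finally have "(B * C * B\<^sup>T)\<^sup>T = B * C * B\<^sup>T" .
  moreover have P: "B * C * B\<^sup>T \<in> carrier_mat n n" using B(1) C'(1) by simp
  moreover have "0\<^sub>m n n \<le> B * C * B\<^sup>T"
  proof -
    have B0: "0 \<le> B $$ (a, p)" if "a < n" "p < k" for a p
      using zero_le_mat_iff[OF B(1)] B(2) that by blast
    have C0: "0 \<le> C $$ (p, q)" if "p < k" "q < k" for p q
      using zero_le_mat_iff[OF C'(1)] C'(3) that by blast
    have "0 \<le> (B * C * B\<^sup>T) $$ (i, j)" if "i < n" "j < n" for i j
      unfolding triple_product_index[OF B(1) C'(1) that]
      using B0 C0 that by (intro sum_nonneg mult_nonneg_nonneg) auto
    then show ?thesis using zero_le_mat_iff[OF P] by blast
  qed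
  ultimately show ?thesis by (simp add: sym_nonneg_mats_def)
qed

section \<open>Edges in terms of an enumeration of the vertices\<close>

lemma vertex_enumeration_image:
  "vertex_enumeration \<phi> G \<Longrightarrow> \<phi> ` {0..<card (verts G)} = verts G"
  by (simp add: vertex_enumeration_def bij_betw_def)

lemma vertex_enumeration_eq_iff:
  "vertex_enumeration \<phi> G \<Longrightarrow> i < card (verts G) \<Longrightarrow> j < card (verts G) \<Longrightarrow> \<phi> i = \<phi> j \<longleftrightarrow> i = j"
  by (auto simp: vertex_enumeration_def bij_betw_def inj_on_def)

lemma edge_set_eq_iff:
  assumes \<phi>: "vertex_enumeration \<phi> G"
    and E: "E \<subseteq> {{u, v} | u v. u \<in> verts G \<and> v \<in> verts G}"
    and F: "F \<subseteq> {{u, v} | u v. u \<in> verts G \<and> v \<in> verts G}"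
  shows "E = F \<longleftrightarrow> (\<forall>i<card (verts G). \<forall>j<card (verts G). {\<phi> i, \<phi> j} \<in> E \<longleftrightarrow> {\<phi> i, \<phi> j} \<in> F)"
proof (intro iffI)
  assume same: "\<forall>i<card (verts G). \<forall>j<card (verts G). {\<phi> i, \<phi> j} \<in> E \<longleftrightarrow> {\<phi> i, \<phi> j} \<in> F"
  have "e \<in> E \<longleftrightarrow> e \<in> F" if e: "e \<in> E \<union> F" for e
  proof -
    obtain u v where uv: "e = {u, v}" "u \<in> verts G" "v \<in> verts G" using e E F by blast
    from uv(2,3) have "u \<in> \<phi> ` {0..<card (verts G)}" "v \<in> \<phi> ` {0..<card (verts G)}"
      using vertex_enumeration_image[OF \<phi>] by simp_all
    then obtain i j where "i < card (verts G)" "j < card (verts G)" "u = \<phi> i" "v = \<phi> j"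
      by auto
    then show ?thesis using uv(1) same by simp
  qed
  then show "E = F" by blast
qed simp

text \<open>
  Symmetry of \<open>A\<close> enters because an edge \<open>{i, j}\<close> does not remember which of the entries
  \<open>(i, j)\<close> and \<open>(j, i)\<close> produced it.
\<close>

lemma mem_sym_nonneg_mats_of_graph_iff:
  assumes G: "finite_loop_graph G" and \<phi>: "vertex_enumeration \<phi> G"
  shows "A \<in> sym_nonneg_mats_of_graph \<phi> G \<longleftrightarrow>
    A \<in> sym_nonneg_mats (card (verts G)) \<and>
    (\<forall>i<card (verts G). \<forall>j<card (verts G). A $$ (i, j) > 0 \<longleftrightarrow> {\<phi> i, \<phi> j} \<in> edges G)"
proof (cases "A \<in> sym_nonneg_mats (card (verts G))")
  case True
  let ?n = "card (verts G)"
  let ?E = "(\<lambda>e. \<phi> ` e) ` edges (pattern_graph A)"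
  have A: "A \<in> carrier_mat ?n ?n" "A\<^sup>T = A" using True by (simp_all add: sym_nonneg_mats_def)
  have sym: "A $$ (i, j) = A $$ (j, i)" if "i < ?n" "j < ?n" for i j
    using A that by (metis carrier_matD index_transpose_mat(1))
  have mem: "{\<phi> i, \<phi> j} \<in> ?E \<longleftrightarrow> A $$ (i, j) > 0" if ij: "i < ?n" "j < ?n" for i j
  proof
    assume "{\<phi> i, \<phi> j} \<in> ?E"
    then obtain a b where ab: "a < ?n" "b < ?n" "A $$ (a, b) > 0" "{\<phi> i, \<phi> j} = {\<phi> a, \<phi> b}"
      using A(1) by (auto simp: pattern_graph_def)
    then have "(i = a \<and> j = b) \<or> (i = b \<and> j = a)"
      using vertex_enumeration_eq_iff[OF \<phi>] ij by (simp add: doubleton_eq_iff)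
    then show "A $$ (i, j) > 0" using ab sym by auto
  next
    assume "A $$ (i, j) > 0"
    then have "{i, j} \<in> edges (pattern_graph A)" using A(1) ij by (auto simp: pattern_graph_def)
    then show "{\<phi> i, \<phi> j} \<in> ?E" by (rule rev_image_eqI) simp
  qed
  have "?E \<subseteq> {{u, v} | u v. u \<in> verts G \<and> v \<in> verts G}"
  proof
    fix e assume "e \<in> ?E"
    then obtain a b where "a < ?n" "b < ?n" "e = {\<phi> a, \<phi> b}"
      using A(1) by (auto simp: pattern_graph_def)
    moreover from this have "\<phi> a \<in> verts G" "\<phi> b \<in> verts G"
      using vertex_enumeration_image[OF \<phi>] by auto
    ultimately show "e \<in> {{u, v} | u v. u \<in> verts G \<and> v \<in> verts G}" by blast
  qed
  moreover have "edges G \<subseteq> {{u, v} | u v. u \<in> verts G \<and> v \<in> verts G}"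
    using G by (simp add: finite_loop_graph_def)
  ultimately have "?E = edges G \<longleftrightarrow>
      (\<forall>i<?n. \<forall>j<?n. {\<phi> i, \<phi> j} \<in> ?E \<longleftrightarrow> {\<phi> i, \<phi> j} \<in> edges G)"
    by (rule edge_set_eq_iff[OF \<phi>])
  also have "\<dots> \<longleftrightarrow> (\<forall>i<?n. \<forall>j<?n. A $$ (i, j) > 0 \<longleftrightarrow> {\<phi> i, \<phi> j} \<in> edges G)"
    by (simp only: mem cong: imp_cong)
  finally have "?E = edges G \<longleftrightarrow>
      (\<forall>i<?n. \<forall>j<?n. A $$ (i, j) > 0 \<longleftrightarrow> {\<phi> i, \<phi> j} \<in> edges G)" .
  moreover have "\<phi> ` verts (pattern_graph A) = verts G"
    using A(1) vertex_enumeration_image[OF \<phi>] by (simp add: pattern_graph_def)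
  then have "relabel \<phi> (pattern_graph A) = G \<longleftrightarrow> ?E = edges G"
    by (cases G) (simp add: relabel_def)
  ultimately show ?thesis using True by (simp add: sym_nonneg_mats_of_graph_def)
qed (simp add: sym_nonneg_mats_of_graph_def)

lemma edge_in_set_join_iff:
  "{u, v} \<in> edges (set_join S K L) \<longleftrightarrow> (u \<in> K \<and> v \<in> L) \<or> (v \<in> K \<and> u \<in> L)"
proof -
  have "{u, v} \<in> edges (set_join S K L) \<longleftrightarrow> (\<exists>i j. {u, v} = {i, j} \<and> i \<in> K \<and> j \<in> L)"
    by (simp add: set_join_def)
  also have "\<dots> \<longleftrightarrow> (u \<in> K \<and> v \<in> L) \<or> (v \<in> K \<and> u \<in> L)"
    unfolding doubleton_eq_iff by metis
  finally show ?thesis .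
qed

lemma is_set_join_cover_iff:
  assumes G: "finite_loop_graph G" and \<phi>: "vertex_enumeration \<phi> G"
  shows "is_set_join_cover \<C> G \<longleftrightarrow>
    finite \<C> \<and> (\<forall>(K, L) \<in> \<C>. K \<noteq> {} \<and> L \<noteq> {} \<and> K \<subseteq> verts G \<and> L \<subseteq> verts G) \<and>
    (\<forall>i<card (verts G). \<forall>j<card (verts G). {\<phi> i, \<phi> j} \<in> edges G \<longleftrightarrow>
       (\<exists>(K, L) \<in> \<C>. (\<phi> i \<in> K \<and> \<phi> j \<in> L) \<or> (\<phi> j \<in> K \<and> \<phi> i \<in> L)))"
proof (cases "\<forall>(K, L) \<in> \<C>. K \<noteq> {} \<and> L \<noteq> {} \<and> K \<subseteq> verts G \<and> L \<subseteq> verts G")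
  case True
  let ?U = "\<Union>(K, L) \<in> \<C>. edges (set_join (verts G) K L)"
  have "edges G \<subseteq> {{u, v} | u v. u \<in> verts G \<and> v \<in> verts G}"
    using G by (simp add: finite_loop_graph_def)
  moreover have "?U \<subseteq> {{u, v} | u v. u \<in> verts G \<and> v \<in> verts G}"
    using True unfolding set_join_def by clarsimp blast
  ultimately have eq: "edges G = ?U \<longleftrightarrow> (\<forall>i<card (verts G). \<forall>j<card (verts G).
      {\<phi> i, \<phi> j} \<in> edges G \<longleftrightarrow> {\<phi> i, \<phi> j} \<in> ?U)"
    by (rule edge_set_eq_iff[OF \<phi>])
  have U: "{u, v} \<in> ?U \<longleftrightarrow> (\<exists>(K, L) \<in> \<C>. (u \<in> K \<and> v \<in> L) \<or> (v \<in> K \<and> u \<in> L))" for u v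
    unfolding UN_iff by (intro bex_cong refl) (auto simp: edge_in_set_join_iff)
  show ?thesis
    unfolding is_set_join_cover_def eq U by (rule refl)
next
  case False
  then show ?thesis unfolding is_set_join_cover_def by argo
qed

section \<open>Covers and factorizations\<close>

lemma ex_snt_factorization_of_cover:
  assumes G: "finite_loop_graph G" and \<phi>: "vertex_enumeration \<phi> G"
    and cov: "is_set_join_cover \<C> G"
  shows "\<exists>A \<in> sym_nonneg_mats_of_graph \<phi> G. snt_factorizable A (cover_order \<C>)"
proof -
  let ?n = "card (verts G)" and ?k = "cover_order \<C>"
  have "finite (cover_components \<C>)"
    using cov by (simp add: is_set_join_cover_def cover_components_def)
  then obtain f where "bij_betw f {0..<?k} (cover_components \<C>)"
    using ex_bij_betw_nat_finite unfolding cover_order_def by blast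
  then have f: "cover_components \<C> = f ` {0..<?k}" by (simp add: bij_betw_def)
  define B :: "real mat" where "B = mat ?n ?k (\<lambda>(i, p). if \<phi> i \<in> f p then 1 else 0)"
  \<comment> \<open>A cover lists each join in one orientation only, while \<open>C\<close> has to be symmetric.\<close>
  define C :: "real mat" where
    "C = mat ?k ?k (\<lambda>(p, q). if (f p, f q) \<in> \<C> \<or> (f q, f p) \<in> \<C> then 1 else 0)"
  define A where "A = B * C * B\<^sup>T"
  have B: "B \<in> carrier_mat ?n ?k" "0\<^sub>m ?n ?k \<le> B" by (auto simp: B_def less_eq_mat_def)
  have "C\<^sup>T = C" by (rule eq_matI) (auto simp: C_def)
  then have C: "C \<in> sym_nonneg_mats ?k"
    by (auto simp: C_def less_eq_mat_def sym_nonneg_mats_def)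
  have comp: "K \<in> cover_components \<C>" "L \<in> cover_components \<C>" if "(K, L) \<in> \<C>" for K L
    using that by (force simp: cover_components_def)+
  have edge: "\<forall>i<?n. \<forall>j<?n. {\<phi> i, \<phi> j} \<in> edges G \<longleftrightarrow>
      (\<exists>(K, L) \<in> \<C>. (\<phi> i \<in> K \<and> \<phi> j \<in> L) \<or> (\<phi> j \<in> K \<and> \<phi> i \<in> L))"
    using cov unfolding is_set_join_cover_iff[OF G \<phi>] by (elim conjE)
  have B_pos: "B $$ (i, p) > 0 \<longleftrightarrow> \<phi> i \<in> f p" if "i < ?n" "p < ?k" for i p
    using that by (simp add: B_def)
  have C_pos: "C $$ (p, q) > 0 \<longleftrightarrow> (f p, f q) \<in> \<C> \<or> (f q, f p) \<in> \<C>"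
    if "p < ?k" "q < ?k" for p q
    using that by (simp add: C_def)
  have "A $$ (i, j) > 0 \<longleftrightarrow> {\<phi> i, \<phi> j} \<in> edges G" if ij: "i < ?n" "j < ?n" for i j
  proof -
    have "A $$ (i, j) > 0 \<longleftrightarrow> (\<exists>p<?k. \<exists>q<?k.
        \<phi> i \<in> f p \<and> ((f p, f q) \<in> \<C> \<or> (f q, f p) \<in> \<C>) \<and> \<phi> j \<in> f q)"
      unfolding A_def snt_product_pos_iff[OF B C ij]
      using B_pos[OF ij(1)] B_pos[OF ij(2)] C_pos by blast
    also have "\<dots> \<longleftrightarrow> (\<exists>K \<in> cover_components \<C>. \<exists>L \<in> cover_components \<C>.
        \<phi> i \<in> K \<and> ((K, L) \<in> \<C> \<or> (L, K) \<in> \<C>) \<and> \<phi> j \<in> L)"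
      unfolding f by (auto simp: Bex_def)
    also have "\<dots> \<longleftrightarrow> (\<exists>(K, L) \<in> \<C>. (\<phi> i \<in> K \<and> \<phi> j \<in> L) \<or> (\<phi> j \<in> K \<and> \<phi> i \<in> L))"
      using comp unfolding Bex_def split_paired_Ex prod.case by blast
    also have "\<dots> \<longleftrightarrow> {\<phi> i, \<phi> j} \<in> edges G"
      by (rule edge[rule_format, OF ij, symmetric])
    finally show ?thesis .
  qed
  moreover have "A \<in> sym_nonneg_mats ?n"
    unfolding A_def by (rule snt_product_sym_nonneg[OF B C])
  ultimately have "A \<in> sym_nonneg_mats_of_graph \<phi> G"
    by (simp add: mem_sym_nonneg_mats_of_graph_iff[OF G \<phi>])
  moreover have "dim_row A = ?n" using B by (simp add: A_def)
  then have "snt_factorizable A ?k"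
    using B C A_def unfolding snt_factorizable_def by auto
  ultimately show ?thesis by blast
qed

text \<open>
  The order of the cover can be smaller than \<open>k\<close>: columns of \<open>B\<close> with equal supports give the same
  component, and a zero column gives none.
\<close>

lemma ex_cover_of_snt_factorization:
  assumes G: "finite_loop_graph G" and \<phi>: "vertex_enumeration \<phi> G"
    and A: "A \<in> sym_nonneg_mats_of_graph \<phi> G" and k: "snt_factorizable A k"
  shows "\<exists>\<C>. is_set_join_cover \<C> G \<and> cover_order \<C> \<le> k"
proof -
  let ?n = "card (verts G)"
  have An: "dim_row A = ?n"
    using A by (auto simp: sym_nonneg_mats_of_graph_def sym_nonneg_mats_def)
  obtain B C where B: "B \<in> carrier_mat ?n k" "0\<^sub>m ?n k \<le> B" and C: "C \<in> sym_nonneg_mats k"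
    and ABC: "A = B * C * B\<^sup>T"
    using k unfolding snt_factorizable_def An by blast
  define K where "K p = {\<phi> i | i. i < ?n \<and> B $$ (i, p) > 0}" for p
  \<comment> \<open>A zero column of \<open>B\<close> has empty support, which is not an admissible component.\<close>
  define J where "J = {(p, q) \<in> {0..<k} \<times> {0..<k}. C $$ (p, q) > 0 \<and> K p \<noteq> {} \<and> K q \<noteq> {}}"
  define \<C> where "\<C> = (\<lambda>(p, q). (K p, K q)) ` J"
  have mem_K: "\<phi> i \<in> K p \<longleftrightarrow> B $$ (i, p) > 0" if "i < ?n" for i p
    using that vertex_enumeration_eq_iff[OF \<phi>] by (auto simp: K_def)
  have K_verts: "K p \<subseteq> verts G" for p
    using vertex_enumeration_image[OF \<phi>] by (auto simp: K_def)
  have C_sym: "C $$ (p, q) = C $$ (q, p)" if "p < k" "q < k" for p q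
    using C that by (metis (mono_tags, lifting) carrier_matD index_transpose_mat(1) mem_Collect_eq
        sym_nonneg_mats_def)
  have "{\<phi> i, \<phi> j} \<in> edges G \<longleftrightarrow>
      (\<exists>(K, L) \<in> \<C>. (\<phi> i \<in> K \<and> \<phi> j \<in> L) \<or> (\<phi> j \<in> K \<and> \<phi> i \<in> L))"
    if ij: "i < ?n" "j < ?n" for i j
  proof -
    have "{\<phi> i, \<phi> j} \<in> edges G \<longleftrightarrow> A $$ (i, j) > 0"
      using A ij by (simp add: mem_sym_nonneg_mats_of_graph_iff[OF G \<phi>])
    also have "\<dots> \<longleftrightarrow> (\<exists>p<k. \<exists>q<k. \<phi> i \<in> K p \<and> C $$ (p, q) > 0 \<and> \<phi> j \<in> K q)"
      unfolding ABC snt_product_pos_iff[OF B C ij] using ij by (simp add: mem_K)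
    also have "\<dots> \<longleftrightarrow> (\<exists>(p, q) \<in> J. \<phi> i \<in> K p \<and> \<phi> j \<in> K q)"
      by (auto simp: J_def)
    \<comment> \<open>An edge is unordered; since \<open>C\<close> is symmetric, the reversed orientation adds nothing new.\<close>
    also have "\<dots> \<longleftrightarrow> (\<exists>(p, q) \<in> J. (\<phi> i \<in> K p \<and> \<phi> j \<in> K q) \<or> (\<phi> j \<in> K p \<and> \<phi> i \<in> K q))"
      using C_sym by (fastforce simp: J_def)
    also have "\<dots> \<longleftrightarrow> (\<exists>(K, L) \<in> \<C>. (\<phi> i \<in> K \<and> \<phi> j \<in> L) \<or> (\<phi> j \<in> K \<and> \<phi> i \<in> L))"
      by (simp add: \<C>_def case_prod_beta)
    finally show ?thesis .
  qed
  moreover have "finite J" by (rule finite_subset[of _ "{0..<k} \<times> {0..<k}"]) (auto simp: J_def)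
  then have "finite \<C>" by (simp add: \<C>_def)
  moreover have "\<forall>(K, L) \<in> \<C>. K \<noteq> {} \<and> L \<noteq> {} \<and> K \<subseteq> verts G \<and> L \<subseteq> verts G"
    using K_verts by (auto simp: \<C>_def J_def)
  ultimately have "is_set_join_cover \<C> G"
    by (simp add: is_set_join_cover_iff[OF G \<phi>])
  moreover have "cover_components \<C> \<subseteq> K ` {0..<k}"
    by (auto simp: cover_components_def \<C>_def J_def)
  then have "cover_order \<C> \<le> k"
    unfolding cover_order_def by (metis card_atLeastLessThan diff_zero finite_atLeastLessThan surj_card_le)
  ultimately show ?thesis by blast
qed

theorem theorem2p11:
  fixes G :: "'a loop_graph" and \<phi> :: "nat \<Rightarrow> 'a"
  assumes "finite_loop_graph G"
    and "vertex_enumeration \<phi> G"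
  shows "st_plus_graph \<phi> G = (LEAST m. \<exists>\<C>. is_set_join_cover \<C> G \<and> m = cover_order \<C>)"
proof (rule antisym)
  let ?P = "\<lambda>m. \<exists>\<C>. is_set_join_cover \<C> G \<and> m = cover_order \<C>"
  have "?P (LEAST m. ?P m)"
    by (rule LeastI_ex) (use ex_set_join_cover[OF assms(1)] in blast)
  then obtain \<C> where \<C>: "is_set_join_cover \<C> G" "(LEAST m. ?P m) = cover_order \<C>" by blast
  obtain A where A: "A \<in> sym_nonneg_mats_of_graph \<phi> G" "snt_factorizable A (cover_order \<C>)"
    using ex_snt_factorization_of_cover[OF assms \<C>(1)] by blast
  have "st_plus_graph \<phi> G \<le> st_plus A"
    unfolding st_plus_graph_def by (rule Least_le) (use A(1) in blast)
  also have "\<dots> \<le> cover_order \<C>" unfolding st_plus_def by (rule Least_le) (rule A(2))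
  finally show "st_plus_graph \<phi> G \<le> (LEAST m. ?P m)" using \<C>(2) by simp
next
  let ?P = "\<lambda>m. \<exists>\<C>. is_set_join_cover \<C> G \<and> m = cover_order \<C>"
  have "st_plus_graph \<phi> G \<in> st_plus ` sym_nonneg_mats_of_graph \<phi> G"
    unfolding st_plus_graph_def
    by (rule LeastI_ex) (use sym_nonneg_mats_of_graph_nonempty[OF assms] in blast)
  then obtain A where A: "A \<in> sym_nonneg_mats_of_graph \<phi> G" "st_plus_graph \<phi> G = st_plus A"
    by blast
  have "A \<in> sym_nonneg_mats (card (verts G))"
    using A(1) by (simp add: sym_nonneg_mats_of_graph_def)
  then have "snt_factorizable A (st_plus A)"
    unfolding st_plus_def by (rule LeastI[OF snt_factorizable_dim])
  then obtain \<C> where \<C>: "is_set_join_cover \<C> G" "cover_order \<C> \<le> st_plus A"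
    using ex_cover_of_snt_factorization[OF assms A(1)] by blast
  have "(LEAST m. ?P m) \<le> cover_order \<C>" by (rule Least_le) (use \<C>(1) in blast)
  then show "(LEAST m. ?P m) \<le> st_plus_graph \<phi> G" using \<C>(2) A(2) by simp
qed

end
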